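(* Let $X_1,X_2,\dots$ be random variables in a separable Hilbert space $H$ such that, for some $\mu\in H$ and constant $\sigma^2$, $\|X_t\|\in[0,\frac12]$, $\mathbb{E}_{t-1}X_t=\mu$ and $\mathbb{E}_{t-1}\|X_t-\mu\|^2=\sigma^2$ for all $t\ge1$. Let $\alpha\in(0,1)$. For any $B_{1/2}(0)$-valued predictable sequence $(\widehat\mu_i^{\mathrm{HS}})_{i\ge1}$, any $[0,1]$-valued predictable sequence $(\widehat\sigma_i)_{i\ge1}$, and any $[0,1)$-valued predictable sequence $(\lambda_i)_{i\ge1}$, the sequence of intervals $(-\infty,U_t^{\mathrm{HS}})$, $t\ge1$, is a $1-\alpha$ (upper) confidence sequence for $\sigma^2$, where $U_t^{\mathrm{HS}}=D_t^{\mathrm{HS}}+R_{t,\alpha}^{\mathrm{HS}}$ with $$D_t^{\mathrm{HS}}=\frac{\sum_{i\le t}\lambda_i\|X_i-\widehat\mu_i^{\mathrm{HS}}\|^2}{\sum_{i\le t}\lambda_i},\quad R_{t,\alpha}^{\mathrm{HS}}=\frac{\log(1/\alpha)+\sum_{i\le t}\psi_E(\lambda_i)\left(\|X_i-\widehat\mu_i^{\mathrm{HS}}\|^2-\widehat\sigma_i^2\right)^2}{\sum_{i\le t}\lambda_i}.$$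
   Context: All random variables live on a common probability space with probability $\mathbb{P}$. $\mathcal{F}_t=\sigma(X_1,\dots,X_t)$ is the canonical filtration, with $\mathcal{F}_0$ trivial; $\mathbb{E}_t[\cdot]=\mathbb{E}[\cdot\mid\mathcal{F}_t]$ (in the Bochner sense for $H$-valued variables). Relations between random variables hold almost surely. A sequence $(M_i)_{i\ge1}$ is predictable if $M_i$ is $\mathcal{F}_{i-1}$-measurable for all $i\ge1$. A sequence of random sets $(C_t)_{t\ge1}$ is a $1-\alpha$ confidence sequence for $\theta$ if $\mathbb{P}(\forall t\ge1:\theta\in C_t)\ge1-\alpha$. $B_r(x)=\{y\in H:\|y-x\|\le r\}$. $\psi_E(\lambda)=-\log(1-\lambda)-\lambda$ for $\lambda\in[0,1)$. Convention: $U_t^{\mathrm{HS}}=+\infty$ at times $t$ with $\sum_{i\le t}\lambda_i=0$. *)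

theory Defs
  imports "HOL-Probability.Probability"
begin

text \<open>The sigma-algebra generated by \<open>X\<^sub>1, \<dots>, X\<^sub>t\<close>. The value \<open>X 0\<close> is never used, and for
  \<open>t = 0\<close> the generating family is empty, so the sigma-algebra is trivial.\<close>

definition canonical_filtration ::
    "'w measure \<Rightarrow> (nat \<Rightarrow> 'w \<Rightarrow> 'a::topological_space) \<Rightarrow> nat \<Rightarrow> 'w measure" where
  "canonical_filtration M X t =
     sigma (space M) (\<Union>i\<in>{1..t}. {X i -` A \<inter> space M | A. A \<in> sets borel})"

lemma space_canonical_filtration [simp]: "space (canonical_filtration M X t) = space M"
  by (auto simp: canonical_filtration_def intro!: space_measure_of)

lemma sets_canonical_filtration_0: "sets (canonical_filtration M X 0) = {{}, space M}"
  by (simp add: canonical_filtration_def sigma_sets_empty_eq)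

lemma subalgebra_canonical_filtration:
  assumes "\<And>i. i \<ge> 1 \<Longrightarrow> X i \<in> borel_measurable M"
  shows "subalgebra M (canonical_filtration M X t)"
proof -
  let ?G = "\<Union>i\<in>{1..t}. {X i -` A \<inter> space M | A. A \<in> sets borel}"
  have G: "?G \<subseteq> sets M"
    using assms by (auto simp: measurable_sets)
  then have "?G \<subseteq> Pow (space M)"
    using sets.space_closed by (rule subset_trans)
  then have "sets (canonical_filtration M X t) = sigma_sets (space M) ?G"
    unfolding canonical_filtration_def by (rule sets_measure_of)
  then show ?thesis
    using sets.sigma_sets_subset[OF G] by (simp add: subalgebra_def)
qed

text \<open>\<open>g\<close> is a version of the Bochner conditional expectation of \<open>f\<close> given \<open>F\<close>; since versions
  agree almost surely, this is what ``\<open>E[f | F] = g\<close> almost surely'' means. It is needed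
  because \<open>real_cond_exp\<close> only covers real-valued functions.\<close>

definition is_cond_exp ::
    "'w measure \<Rightarrow> 'w measure \<Rightarrow> ('w \<Rightarrow> 'a::{banach, second_countable_topology}) \<Rightarrow> ('w \<Rightarrow> 'a) \<Rightarrow> bool"
  where
  "is_cond_exp M F f g \<longleftrightarrow>
     subalgebra M F \<and> integrable M f \<and> integrable M g \<and> g \<in> borel_measurable F \<and>
     (\<forall>A\<in>sets F. set_lebesgue_integral M A f = set_lebesgue_integral M A g)"

definition predictable :: "(nat \<Rightarrow> 'w measure) \<Rightarrow> (nat \<Rightarrow> 'w \<Rightarrow> 'b::topological_space) \<Rightarrow> bool" where
  "predictable F Y \<longleftrightarrow> (\<forall>i\<ge>1. Y i \<in> borel_measurable (F (i - 1)))"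

definition confidence_sequence ::
    "'w measure \<Rightarrow> real \<Rightarrow> 'b \<Rightarrow> (nat \<Rightarrow> 'w \<Rightarrow> 'b set) \<Rightarrow> bool" where
  "confidence_sequence M \<alpha> \<theta> C \<longleftrightarrow>
     {\<omega>\<in>space M. \<forall>t\<ge>1. \<theta> \<in> C t \<omega>} \<in> sets M \<and>
     measure M {\<omega>\<in>space M. \<forall>t\<ge>1. \<theta> \<in> C t \<omega>} \<ge> 1 - \<alpha>"

definition psi_E :: "real \<Rightarrow> real" where
  "psi_E l = - ln (1 - l) - l"

definition D_HS ::
    "(nat \<Rightarrow> 'w \<Rightarrow> 'a::real_normed_vector) \<Rightarrow> (nat \<Rightarrow> 'w \<Rightarrow> 'a) \<Rightarrow> (nat \<Rightarrow> 'w \<Rightarrow> real) \<Rightarrow>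
     nat \<Rightarrow> 'w \<Rightarrow> real" where
  "D_HS X \<mu>h lam t \<omega> =
     (\<Sum>i=1..t. lam i \<omega> * (norm (X i \<omega> - \<mu>h i \<omega>))\<^sup>2) / (\<Sum>i=1..t. lam i \<omega>)"

definition R_HS ::
    "(nat \<Rightarrow> 'w \<Rightarrow> 'a::real_normed_vector) \<Rightarrow> (nat \<Rightarrow> 'w \<Rightarrow> 'a) \<Rightarrow> (nat \<Rightarrow> 'w \<Rightarrow> real) \<Rightarrow>
     (nat \<Rightarrow> 'w \<Rightarrow> real) \<Rightarrow> real \<Rightarrow> nat \<Rightarrow> 'w \<Rightarrow> real" where
  "R_HS X \<mu>h \<sigma>h lam \<alpha> t \<omega> =
     (ln (1 / \<alpha>) +
       (\<Sum>i=1..t. psi_E (lam i \<omega>) * ((norm (X i \<omega> - \<mu>h i \<omega>))\<^sup>2 - (\<sigma>h i \<omega>)\<^sup>2)\<^sup>2)) /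
     (\<Sum>i=1..t. lam i \<omega>)"

text \<open>Extended-real valued: the bound is \<open>\<infinity>\<close> as long as all weights so far vanish.\<close>

definition U_HS ::
    "(nat \<Rightarrow> 'w \<Rightarrow> 'a::real_normed_vector) \<Rightarrow> (nat \<Rightarrow> 'w \<Rightarrow> 'a) \<Rightarrow> (nat \<Rightarrow> 'w \<Rightarrow> real) \<Rightarrow>
     (nat \<Rightarrow> 'w \<Rightarrow> real) \<Rightarrow> real \<Rightarrow> nat \<Rightarrow> 'w \<Rightarrow> ereal" where
  "U_HS X \<mu>h \<sigma>h lam \<alpha> t \<omega> =
     (if (\<Sum>i=1..t. lam i \<omega>) = 0 then \<infinity>
      else ereal (D_HS X \<mu>h lam t \<omega> + R_HS X \<mu>h \<sigma>h lam \<alpha> t \<omega>))"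

end

theory Submission
  imports Defs
begin

text \<open>
  Write \<open>Y\<^sub>i = \<parallel>X\<^sub>i - \<mu>h\<^sub>i\<parallel>\<^sup>2\<close>, which lies in \<open>[0,1]\<close>. For positive total weight, clearing the
  denominator in \<open>\<sigma>\<^sup>2 < U\<^sub>t\<close> and exponentiating turns it into \<open>S\<^sub>t < 1/\<alpha>\<close> for the process
  \<open>S\<^sub>t = \<Prod>\<^sub>i\<^sub>\<le>\<^sub>t exp (\<lambda>\<^sub>i (\<sigma>\<^sup>2 - Y\<^sub>i) - \<psi>\<^sub>E(\<lambda>\<^sub>i) (Y\<^sub>i - \<sigma>h\<^sub>i\<^sup>2)\<^sup>2)\<close> (\<open>less_U_HS_iff\<close>). This
  process is a nonnegative supermartingale with \<open>S\<^sub>0 = 1\<close>, so Ville's inequality bounds by \<open>\<alpha>\<close>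
  the probability that it ever reaches \<open>1/\<alpha>\<close> (\<open>ville_inequality\<close>).

  The supermartingale property (\<open>hs_factor_step\<close>) has two ingredients. The first is Fan's
  inequality \<open>exp (l x - \<psi>\<^sub>E(l) x\<^sup>2) \<le> 1 + l x\<close> for \<open>x \<ge> -1\<close>, used with \<open>x = \<sigma>h\<^sub>i\<^sup>2 - Y\<^sub>i\<close>: it
  makes the \<open>i\<close>-th factor at most \<open>exp (\<lambda>\<^sub>i (\<sigma>\<^sup>2 - \<sigma>h\<^sub>i\<^sup>2)) (1 + \<lambda>\<^sub>i (\<sigma>h\<^sub>i\<^sup>2 - Y\<^sub>i))\<close>,
  which is affine in \<open>Y\<^sub>i\<close>, so only the conditional mean of \<open>Y\<^sub>i\<close> matters. The second is the
  bias-variance decomposition \<open>E\<^sub>i\<^sub>-\<^sub>1 Y\<^sub>i = \<sigma>\<^sup>2 + \<parallel>\<mu> - \<mu>h\<^sub>i\<parallel>\<^sup>2 \<ge> \<sigma>\<^sup>2\<close>: guessing the mean wrongly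
  only raises the mean squared distance, which is the safe direction for an upper bound. With
  \<open>1 + z \<le> exp z\<close> the conditional mean of the factor is then at most \<open>1\<close>.

  Conditional expectations enter in integrated form throughout, tested against integrable
  functions measurable for the past.
\<close>

section \<open>Fan's exponential inequality\<close>

text \<open>Both sides agree at \<open>l = 0\<close>. In \<open>l\<close>, with \<open>x\<close> fixed, the difference of the logarithms has
  derivative \<open>l x\<^sup>2 (1/(1-l) - 1/(1+lx))\<close>, which is nonnegative because \<open>1 + l x \<ge> 1 - l\<close>.\<close>

lemma exp_psi_E_le:
  fixes l x :: real
  assumes l: "0 \<le> l" "l < 1" and x: "-1 \<le> x"
  shows "exp (l * x - psi_E l * x\<^sup>2) \<le> 1 + l * x"
proof -
  define h where "h = (\<lambda>k. ln (1 + k * x) - k * x + psi_E k * x\<^sup>2)"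
  have lower: "1 - k \<le> 1 + k * x" if "0 \<le> k" for k
    using mult_left_mono[OF x that] by simp
  have "h 0 \<le> h l"
  proof (rule DERIV_nonneg_imp_nondecreasing[OF l(1)])
    fix k assume k: "0 \<le> k" "k \<le> l"
    with l lower[of k] have pos: "0 < 1 - k" "0 < 1 + k * x" by linarith+
    have "(h has_real_derivative k * x\<^sup>2 * (1 / (1 - k) - 1 / (1 + k * x))) (at k)"
      unfolding h_def psi_E_def using pos
      by (auto intro!: derivative_eq_intros simp: divide_simps)
         (simp add: algebra_simps power2_eq_square)
    moreover have "1 / (1 + k * x) \<le> 1 / (1 - k)"
      using pos lower[OF k(1)] by (simp add: frac_le)
    ultimately show "\<exists>y. (h has_real_derivative y) (at k) \<and> 0 \<le> y"
      using k by (metis diff_ge_0_iff_ge mult_nonneg_nonneg zero_le_power2)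
  qed
  then have "l * x - psi_E l * x\<^sup>2 \<le> ln (1 + l * x)"
    by (simp add: h_def psi_E_def)
  moreover have "0 < 1 + l * x"
    using lower[OF l(1)] l(2) by linarith
  ultimately show ?thesis
    by (metis exp_le_cancel_iff exp_ln)
qed

section \<open>Conditional second moments\<close>

lemma integrable_inner_bounded:
  fixes f W :: "'w \<Rightarrow> 'h::{real_inner, banach, second_countable_topology}"
  assumes f: "f \<in> borel_measurable M" "AE \<omega> in M. norm (f \<omega>) \<le> C"
    and W: "integrable M W"
  shows "integrable M (\<lambda>\<omega>. f \<omega> \<bullet> W \<omega>)"
proof (rule Bochner_Integration.integrable_bound)
  show "integrable M (\<lambda>\<omega>. C * norm (W \<omega>))"
    using W by (intro integrable_mult_right integrable_norm)
  show "(\<lambda>\<omega>. f \<omega> \<bullet> W \<omega>) \<in> borel_measurable M"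
    using f W by measurable
  show "AE \<omega> in M. norm (f \<omega> \<bullet> W \<omega>) \<le> norm (C * norm (W \<omega>))"
    using f(2)
  proof eventually_elim
    case (elim \<omega>)
    have "\<bar>f \<omega> \<bullet> W \<omega>\<bar> \<le> norm (f \<omega>) * norm (W \<omega>)" by (rule Cauchy_Schwarz_ineq2)
    also have "\<dots> \<le> C * norm (W \<omega>)" using elim by (intro mult_right_mono) auto
    finally show ?case by simp
  qed
qed

text \<open>The residual of a conditional expectation is orthogonal to everything known in the past. The
  defining property of the conditional expectation is the case of an indicator times a constant
  vector; linearity and dominated convergence extend it to integrable \<open>W\<close>, the residual being
  bounded.\<close>

lemma integral_inner_cond_exp_residual:
  fixes f g W :: "'w \<Rightarrow> 'h::{real_inner, banach, second_countable_topology}"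
  assumes ce: "is_cond_exp M F f g"
    and bnd: "AE \<omega> in M. norm (f \<omega> - g \<omega>) \<le> C"
    and W: "integrable M W" "W \<in> borel_measurable F"
  shows "(\<integral>\<omega>. (f \<omega> - g \<omega>) \<bullet> W \<omega> \<partial>M) = 0"
proof -
  have sub: "subalgebra M F" and fg: "integrable M f" "integrable M g"
    and eq: "\<And>A. A \<in> sets F \<Longrightarrow> set_lebesgue_integral M A f = set_lebesgue_integral M A g"
    using ce by (auto simp: is_cond_exp_def)
  note [measurable] = borel_measurable_integrable[OF fg(1)] borel_measurable_integrable[OF fg(2)]
  have int: "integrable M (\<lambda>\<omega>. (f \<omega> - g \<omega>) \<bullet> V \<omega>)" if "integrable M V" for V
    by (rule integrable_inner_bounded[OF _ bnd that]) measurable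
  have from_sub: "integrable M V" if "integrable (restr_to_subalg M F) V"
    for V :: "'w \<Rightarrow> 'h"
    by (rule integrable_from_subalg[OF sub that])
  have "integrable (restr_to_subalg M F) W"
    by (rule integrable_in_subalg[OF sub W(2,1)])
  then show ?thesis
  proof induction
    case (base A c)
    then have A: "A \<in> sets F" "A \<in> sets M"
      using sub by (auto simp: sets_restr_to_subalg[OF sub] subalgebra_def)
    have i: "integrable M (\<lambda>\<omega>. indicator A \<omega> *\<^sub>R f \<omega>)" "integrable M (\<lambda>\<omega>. indicator A \<omega> *\<^sub>R g \<omega>)"
      using A fg by (auto intro: integrable_mult_indicator)
    have "(\<integral>\<omega>. (f \<omega> - g \<omega>) \<bullet> (indicator A \<omega> *\<^sub>R c) \<partial>M)
        = (\<integral>\<omega>. (indicator A \<omega> *\<^sub>R f \<omega> - indicator A \<omega> *\<^sub>R g \<omega>) \<bullet> c \<partial>M)"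
      by (simp add: scaleR_diff_right[symmetric])
    also have "\<dots> = (\<integral>\<omega>. indicator A \<omega> *\<^sub>R f \<omega> - indicator A \<omega> *\<^sub>R g \<omega> \<partial>M) \<bullet> c"
      using i by (intro integral_inner_left) auto
    also have "\<dots> = 0"
      using eq[OF A(1)] i by (simp add: set_lebesgue_integral_def)
    finally show ?case .
  next
    case (add V V')
    have "(\<integral>\<omega>. (f \<omega> - g \<omega>) \<bullet> (V \<omega> + V' \<omega>) \<partial>M)
        = (\<integral>\<omega>. (f \<omega> - g \<omega>) \<bullet> V \<omega> + (f \<omega> - g \<omega>) \<bullet> V' \<omega> \<partial>M)"
      by (simp add: inner_add_right)
    also have "\<dots> = 0"
      using add int[OF from_sub] by simp
    finally show ?case .
  next
    case (lim V s)
    have sp: "space (restr_to_subalg M F) = space M"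
      by (rule space_restr_to_subalg)
    note V = from_sub[OF lim.hyps(4)] and s = from_sub[OF lim.hyps(1)]
    have "(\<lambda>i. \<integral>\<omega>. (f \<omega> - g \<omega>) \<bullet> s i \<omega> \<partial>M) \<longlonglongrightarrow> (\<integral>\<omega>. (f \<omega> - g \<omega>) \<bullet> V \<omega> \<partial>M)"
    proof (rule integral_dominated_convergence)
      show "integrable M (\<lambda>\<omega>. C * (2 * norm (V \<omega>)))"
        using V by (intro integrable_mult_right integrable_norm)
      show "(\<lambda>\<omega>. (f \<omega> - g \<omega>) \<bullet> V \<omega>) \<in> borel_measurable M"
        using int[OF V] by measurable
      show "(\<lambda>\<omega>. (f \<omega> - g \<omega>) \<bullet> s i \<omega>) \<in> borel_measurable M" for i
        using int[OF s] by measurable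
      show "AE \<omega> in M. (\<lambda>i. (f \<omega> - g \<omega>) \<bullet> s i \<omega>) \<longlonglongrightarrow> (f \<omega> - g \<omega>) \<bullet> V \<omega>"
        using lim.hyps(2) by (intro AE_I2 tendsto_intros) (simp add: sp)
      show "AE \<omega> in M. norm ((f \<omega> - g \<omega>) \<bullet> s i \<omega>) \<le> C * (2 * norm (V \<omega>))" for i
        using bnd AE_space
      proof eventually_elim
        case (elim \<omega>)
        have "\<bar>(f \<omega> - g \<omega>) \<bullet> s i \<omega>\<bar> \<le> norm (f \<omega> - g \<omega>) * norm (s i \<omega>)"
          by (rule Cauchy_Schwarz_ineq2)
        also have "\<dots> \<le> C * (2 * norm (V \<omega>))"
          using elim lim.hyps(3)[of \<omega> i] by (intro mult_mono) (auto simp: sp intro: order_trans[OF norm_ge_zero])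
        finally show ?case by simp
      qed
    qed
    then show ?case
      using lim.IH by (simp add: LIMSEQ_const_iff)
  qed
qed

section \<open>Ville's maximal inequality\<close>

text \<open>Let \<open>A\<^sub>t\<close> be the event that the level \<open>c\<close> has not been reached up to time \<open>t\<close>. The process
  stopped on reaching the level, and truncated to \<open>c\<close> there, has mean
  \<open>E[S\<^sub>t; A\<^sub>t] + c (1 - P(A\<^sub>t))\<close>. This stays at most \<open>1\<close>: the supermartingale property on
  \<open>A\<^sub>t\<close> handles the step from \<open>S\<^sub>t\<close> to \<open>S\<^sub>t\<^sub>+\<^sub>1\<close>, and on \<open>A\<^sub>t - A\<^sub>t\<^sub>+\<^sub>1\<close> the new value is at
  least \<open>c\<close>. Dropping the first summand and letting \<open>t\<close> tend to infinity gives the claim.\<close>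

lemma (in prob_space) ville_inequality:
  fixes S :: "nat \<Rightarrow> 'a \<Rightarrow> real" and F :: "nat \<Rightarrow> 'a measure" and c :: real
  assumes sub: "\<And>t. subalgebra M (F t)" and mono: "\<And>t. sets (F t) \<subseteq> sets (F (Suc t))"
    and adapted: "\<And>t. S t \<in> borel_measurable (F t)"
    and int: "\<And>t. integrable M (S t)"
    and nonneg: "\<And>t \<omega>. 0 \<le> S t \<omega>"
    and super: "\<And>t B. B \<in> sets (F t) \<Longrightarrow>
      (\<integral>\<omega>. indicator B \<omega> * S (Suc t) \<omega> \<partial>M) \<le> (\<integral>\<omega>. indicator B \<omega> * S t \<omega> \<partial>M)"
    and init: "expectation (S 0) \<le> 1" and c: "0 < c"
  shows "1 - 1 / c \<le> prob {\<omega>\<in>space M. \<forall>t. S t \<omega> < c}"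
proof -
  have spF: "space (F t) = space M" for t using sub[of t] by (simp add: subalgebra_def)
  define A where "A t = {\<omega>\<in>space M. \<forall>s\<le>t. S s \<omega> < c}" for t
  have A_Suc: "A (Suc t) = A t \<inter> {\<omega>\<in>space M. S (Suc t) \<omega> < c}" for t
    by (auto simp: A_def le_Suc_eq)
  have level: "{\<omega>\<in>space M. S t \<omega> < c} \<in> sets (F t)" for t
    using borel_measurable_less[OF adapted[of t] borel_measurable_const[of c]] by (simp add: spF)
  have AF: "A t \<in> sets (F t)" for t
  proof (induction t)
    case 0
    then show ?case using level[of 0] by (simp add: A_def)
  next
    case (Suc t)
    then show ?case unfolding A_Suc using mono level by (intro sets.Int) auto
  qed
  have AM [measurable]: "A t \<in> sets M" for t using AF sub unfolding subalgebra_def by blast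
  have iA: "integrable M (\<lambda>\<omega>. indicator B \<omega> * S t \<omega>)" if "B \<in> sets M" for B t
    using integrable_mult_indicator[OF that int[of t]] by simp
  have i1: "integrable M (indicator B :: 'a \<Rightarrow> real)" if "B \<in> sets M" for B
    using that by (simp add: emeasure_eq_measure)
  have key: "(\<integral>\<omega>. indicator (A t) \<omega> * S t \<omega> \<partial>M) + c * (1 - prob (A t)) \<le> 1" for t
  proof (induction t)
    case 0
    have "(\<integral>\<omega>. indicator (A 0) \<omega> * S 0 \<omega> \<partial>M) + c * (1 - prob (A 0))
        = (\<integral>\<omega>. indicator (A 0) \<omega> * S 0 \<omega> + c * (1 - indicator (A 0) \<omega>) \<partial>M)"
      using iA i1 AM by (simp add: prob_space)
    also have "\<dots> \<le> expectation (S 0)"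
    proof (rule integral_mono[OF _ int])
      show "integrable M (\<lambda>\<omega>. indicator (A 0) \<omega> * S 0 \<omega> + c * (1 - indicator (A 0) \<omega>))"
        using iA i1 AM by simp
    qed (auto simp: A_def indicator_def)
    finally show ?case using init by simp
  next
    case (Suc t)
    have "(\<integral>\<omega>. indicator (A (Suc t)) \<omega> * S (Suc t) \<omega> \<partial>M) + c * (prob (A t) - prob (A (Suc t)))
        = (\<integral>\<omega>. indicator (A (Suc t)) \<omega> * S (Suc t) \<omega>
            + c * (indicator (A t) \<omega> - indicator (A (Suc t)) \<omega>) \<partial>M)"
      using iA i1 AM by simp
    also have "\<dots> \<le> (\<integral>\<omega>. indicator (A t) \<omega> * S (Suc t) \<omega> \<partial>M)"
    proof (rule integral_mono[OF _ iA[OF AM]])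
      show "integrable M (\<lambda>\<omega>. indicator (A (Suc t)) \<omega> * S (Suc t) \<omega>
          + c * (indicator (A t) \<omega> - indicator (A (Suc t)) \<omega>))"
        using iA i1 AM by simp
    qed (auto simp: A_Suc indicator_def nonneg)
    also have "\<dots> \<le> (\<integral>\<omega>. indicator (A t) \<omega> * S t \<omega> \<partial>M)"
      by (rule super[OF AF])
    finally show ?case using Suc by (simp add: algebra_simps)
  qed
  have lower: "1 - 1 / c \<le> prob (A t)" for t
  proof -
    have "0 \<le> (\<integral>\<omega>. indicator (A t) \<omega> * S t \<omega> \<partial>M)"
      using nonneg by (intro integral_nonneg_AE) auto
    with key[of t] have "c * (1 - prob (A t)) \<le> 1" by linarith
    then have "1 - prob (A t) \<le> 1 / c" using c by (simp add: pos_le_divide_eq mult.commute)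
    then show ?thesis by simp
  qed
  have "(\<lambda>t. prob (A t)) \<longlonglongrightarrow> prob (\<Inter>t. A t)"
  proof (rule finite_Lim_measure_decseq)
    show "range A \<subseteq> events" using AM by auto
    show "decseq A" unfolding decseq_Suc_iff A_Suc by auto
  qed
  moreover have "(\<Inter>t. A t) = {\<omega>\<in>space M. \<forall>t. S t \<omega> < c}"
    by (auto simp: A_def)
  ultimately have "(\<lambda>t. prob (A t)) \<longlonglongrightarrow> prob {\<omega>\<in>space M. \<forall>t. S t \<omega> < c}"
    by simp
  then show ?thesis
    by (rule LIMSEQ_le_const) (use lower in blast)
qed

text \<open>Bias-variance decomposition, tested against a weight \<open>K\<close> from the past: expand
  \<open>\<parallel>X - m\<parallel>\<^sup>2\<close> around \<open>\<mu>\<close>. The cross term is the inner product of \<open>X - \<mu>\<close> with the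
  past-measurable vector \<open>2K(\<mu> - m)\<close> and integrates to zero; the squared bias is nonnegative.\<close>

lemma (in prob_space) variance_le_conditional_second_moment:
  fixes X m :: "'a \<Rightarrow> 'h::{real_inner, banach, second_countable_topology}" and K :: "'a \<Rightarrow> real"
  assumes X: "X \<in> borel_measurable M" "AE \<omega> in M. norm (X \<omega>) \<le> C"
    and ce: "is_cond_exp M F X (\<lambda>_. \<mu>)"
    and var: "AE \<omega> in M. real_cond_exp M F (\<lambda>\<omega>. (norm (X \<omega> - \<mu>))\<^sup>2) \<omega> = v"
    and m: "m \<in> borel_measurable F" "AE \<omega> in M. norm (m \<omega>) \<le> C"
    and K: "integrable M K" "K \<in> borel_measurable F" "AE \<omega> in M. 0 \<le> K \<omega>"
  shows "v * expectation K \<le> expectation (\<lambda>\<omega>. K \<omega> * (norm (X \<omega> - m \<omega>))\<^sup>2)"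
proof -
  have sub: "subalgebra M F" using ce by (simp add: is_cond_exp_def)
  interpret finite_measure_subalgebra M F
    by unfold_locales (rule sub)
  have mM: "m \<in> borel_measurable M" and KM: "K \<in> borel_measurable M"
    using m K measurable_from_subalg[OF sub] by auto
  note [measurable] = X(1) mM KM
  have int: "integrable M (\<lambda>\<omega>. K \<omega> * (norm (X \<omega> - g \<omega>))\<^sup>2)"
    if g: "g \<in> borel_measurable M" "AE \<omega> in M. norm (g \<omega>) \<le> B" for g :: "'a \<Rightarrow> 'h" and B
  proof -
    have "integrable M (\<lambda>\<omega>. (norm (X \<omega> - g \<omega>))\<^sup>2 \<bullet> K \<omega>)"
    proof (rule integrable_inner_bounded[OF _ _ K(1)])
      show "(\<lambda>\<omega>. (norm (X \<omega> - g \<omega>))\<^sup>2) \<in> borel_measurable M" using g by measurable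
      show "AE \<omega> in M. norm ((norm (X \<omega> - g \<omega>))\<^sup>2) \<le> (C + B)\<^sup>2"
        using X(2) g(2)
      proof eventually_elim
        case (elim \<omega>)
        have "norm (X \<omega> - g \<omega>) \<le> C + B" using elim norm_triangle_ineq4[of "X \<omega>" "g \<omega>"] by linarith
        then show ?case by (simp add: power_mono)
      qed
    qed
    then show ?thesis by (simp add: mult.commute)
  qed
  define W where "W = (\<lambda>\<omega>. K \<omega> *\<^sub>R (\<mu> - m \<omega>))"
  have WF: "W \<in> borel_measurable F" unfolding W_def using K(2) m(1) by measurable
  have WM: "W \<in> borel_measurable M" unfolding W_def by measurable
  have W: "integrable M W"
  proof (rule Bochner_Integration.integrable_bound)
    show "integrable M (\<lambda>\<omega>. (norm \<mu> + C) * K \<omega>)" using K(1) by (rule integrable_mult_right)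
    show "AE \<omega> in M. norm (W \<omega>) \<le> norm ((norm \<mu> + C) * K \<omega>)"
      using m(2)
    proof eventually_elim
      case (elim \<omega>)
      have "norm (\<mu> - m \<omega>) \<le> norm \<mu> + C" using elim norm_triangle_ineq4[of \<mu> "m \<omega>"] by linarith
      then have "norm (\<mu> - m \<omega>) \<le> \<bar>norm \<mu> + C\<bar>" by linarith
      then show ?case by (simp add: W_def abs_mult mult.commute mult_left_mono)
    qed
  qed (rule WM)
  have bnd: "AE \<omega> in M. norm (X \<omega> - \<mu>) \<le> C + norm \<mu>"
    using X(2) by eventually_elim (use norm_triangle_ineq4 in \<open>smt (verit)\<close>)
  have cross: "(\<integral>\<omega>. (X \<omega> - \<mu>) \<bullet> W \<omega> \<partial>M) = 0"
    by (rule integral_inner_cond_exp_residual[OF ce bnd W WF])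
  have icross: "integrable M (\<lambda>\<omega>. (X \<omega> - \<mu>) \<bullet> W \<omega>)"
    by (rule integrable_inner_bounded[OF _ bnd W]) measurable
  have imu: "integrable M (\<lambda>\<omega>. K \<omega> * (norm (X \<omega> - \<mu>))\<^sup>2)"
    by (rule int[OF borel_measurable_const AE_I2[OF order_refl]])
  have "v * expectation K = (\<integral>\<omega>. K \<omega> * real_cond_exp M F (\<lambda>\<omega>. (norm (X \<omega> - \<mu>))\<^sup>2) \<omega> \<partial>M)"
    unfolding integral_mult_right_zero[symmetric]
  proof (rule integral_cong_AE)
    show "AE \<omega> in M. v * K \<omega> = K \<omega> * real_cond_exp M F (\<lambda>\<omega>. (norm (X \<omega> - \<mu>))\<^sup>2) \<omega>"
      using var by eventually_elim simp
  qed measurable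
  also have "\<dots> = (\<integral>\<omega>. K \<omega> * (norm (X \<omega> - \<mu>))\<^sup>2 \<partial>M)"
    by (rule real_cond_exp_intg(2)[OF imu K(2)]) measurable
  also have "\<dots> = (\<integral>\<omega>. K \<omega> * (norm (X \<omega> - \<mu>))\<^sup>2 + 2 * ((X \<omega> - \<mu>) \<bullet> W \<omega>) \<partial>M)"
    using cross icross imu by simp
  also have "\<dots> \<le> (\<integral>\<omega>. K \<omega> * (norm (X \<omega> - m \<omega>))\<^sup>2 \<partial>M)"
  proof (rule integral_mono_AE)
    show "integrable M (\<lambda>\<omega>. K \<omega> * (norm (X \<omega> - m \<omega>))\<^sup>2)"
      by (rule int[OF mM m(2)])
    show "AE \<omega> in M. K \<omega> * (norm (X \<omega> - \<mu>))\<^sup>2 + 2 * ((X \<omega> - \<mu>) \<bullet> W \<omega>)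
        \<le> K \<omega> * (norm (X \<omega> - m \<omega>))\<^sup>2"
      using K(3)
    proof eventually_elim
      case (elim \<omega>)
      have "(norm (X \<omega> - m \<omega>))\<^sup>2 = (norm (X \<omega> - \<mu>))\<^sup>2 + 2 * ((X \<omega> - \<mu>) \<bullet> (\<mu> - m \<omega>)) + (norm (\<mu> - m \<omega>))\<^sup>2"
        by (simp add: power2_norm_eq_inner inner_diff_left inner_diff_right inner_commute)
      moreover have "0 \<le> K \<omega> * (norm (\<mu> - m \<omega>))\<^sup>2" using elim by simp
      moreover have "(X \<omega> - \<mu>) \<bullet> W \<omega> = K \<omega> * ((X \<omega> - \<mu>) \<bullet> (\<mu> - m \<omega>))"
        by (simp add: W_def)
      ultimately show ?case by (simp add: distrib_left mult.left_commute)
    qed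
  qed (use icross imu in auto)
  finally show ?thesis .
qed

section \<open>The supermartingale factor\<close>

definition hs_factor :: "real \<Rightarrow> real \<Rightarrow> real \<Rightarrow> real \<Rightarrow> real" where
  "hs_factor v l s y = exp (l * (v - y) - psi_E l * (y - s\<^sup>2)\<^sup>2)"

lemma hs_factor_measurable [measurable (raw)]:
  assumes "l \<in> borel_measurable N" "s \<in> borel_measurable N" "y \<in> borel_measurable N"
  shows "(\<lambda>\<omega>. hs_factor v (l \<omega>) (s \<omega>) (y \<omega>)) \<in> borel_measurable N"
  unfolding hs_factor_def psi_E_def using assms by measurable

text \<open>Fan's inequality applied to \<open>s\<^sup>2 - y\<close>, after splitting
  \<open>v - y = (v - s\<^sup>2) + (s\<^sup>2 - y)\<close>. The bound is affine in \<open>y\<close>.\<close>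

lemma hs_factor_le:
  assumes "0 \<le> l" "l < 1" "\<bar>s\<bar> \<le> 1" "0 \<le> y" "y \<le> 1"
  shows "hs_factor v l s y \<le> exp (l * (v - s\<^sup>2)) * (1 + l * (s\<^sup>2 - y))"
proof -
  have "-1 \<le> s\<^sup>2 - y" using assms by (smt (verit) zero_le_power2)
  then have "exp (l * (s\<^sup>2 - y) - psi_E l * (s\<^sup>2 - y)\<^sup>2) \<le> 1 + l * (s\<^sup>2 - y)"
    using assms by (intro exp_psi_E_le)
  moreover have "hs_factor v l s y
      = exp (l * (v - s\<^sup>2)) * exp (l * (s\<^sup>2 - y) - psi_E l * (s\<^sup>2 - y)\<^sup>2)"
    by (simp add: hs_factor_def exp_add[symmetric] power2_commute algebra_simps)
  ultimately show ?thesis by simp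
qed

text \<open>The supermartingale property of one factor, tested against a weight \<open>G\<close> from the past. After
  the affine bound, \<open>Y\<close> occurs only multiplied by a nonnegative past-measurable weight \<open>K\<close>, so
  it may be replaced there by the lower bound \<open>v\<close> of its conditional mean; what remains is at most \<open>G\<close> because
  \<open>exp z (1 - z) \<le> 1\<close> for \<open>z = l (v - s\<^sup>2)\<close>.\<close>

lemma (in prob_space) hs_factor_step:
  fixes X m :: "'a \<Rightarrow> 'h::{real_inner, banach, second_countable_topology}" and l s G :: "'a \<Rightarrow> real"
  assumes X: "X \<in> borel_measurable M" "AE \<omega> in M. norm (X \<omega>) \<le> 1/2"
    and ce: "is_cond_exp M F X (\<lambda>_. \<mu>)"
    and var: "AE \<omega> in M. real_cond_exp M F (\<lambda>\<omega>. (norm (X \<omega> - \<mu>))\<^sup>2) \<omega> = v" and v: "0 \<le> v"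
    and m: "m \<in> borel_measurable F" "AE \<omega> in M. norm (m \<omega>) \<le> 1/2"
    and s: "s \<in> borel_measurable F" "AE \<omega> in M. \<bar>s \<omega>\<bar> \<le> 1"
    and l: "l \<in> borel_measurable F" "AE \<omega> in M. 0 \<le> l \<omega> \<and> l \<omega> < 1"
    and G: "integrable M G" "G \<in> borel_measurable F" "\<And>\<omega>. 0 \<le> G \<omega>"
  defines "Q \<equiv> \<lambda>\<omega>. G \<omega> * hs_factor v (l \<omega>) (s \<omega>) ((norm (X \<omega> - m \<omega>))\<^sup>2)"
  shows "integrable M Q" "expectation Q \<le> expectation G"
proof -
  have sub: "subalgebra M F" using ce by (simp add: is_cond_exp_def)
  note toM = measurable_from_subalg[OF sub]
  note [measurable] = X(1) toM[OF m(1)] toM[OF s(1)] toM[OF l(1)] toM[OF G(2)]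
  define Y where "Y = (\<lambda>\<omega>. (norm (X \<omega> - m \<omega>))\<^sup>2)"
  have [measurable]: "Y \<in> borel_measurable M" unfolding Y_def by measurable
  have Y: "AE \<omega> in M. 0 \<le> Y \<omega> \<and> Y \<omega> \<le> 1"
    using X(2) m(2)
  proof eventually_elim
    case (elim \<omega>)
    have "norm (X \<omega> - m \<omega>) \<le> 1" using elim norm_triangle_ineq4[of "X \<omega>" "m \<omega>"] by linarith
    then show ?case by (simp add: Y_def power_le_one)
  qed
  have ranges: "AE \<omega> in M. 0 \<le> Y \<omega> \<and> Y \<omega> \<le> 1 \<and> \<bar>s \<omega>\<bar> \<le> 1 \<and> (s \<omega>)\<^sup>2 \<le> 1 \<and> 0 \<le> l \<omega> \<and> l \<omega> < 1"
    using Y s(2) l(2) by eventually_elim (simp add: abs_square_le_1)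
  have mult_int: "integrable M (\<lambda>\<omega>. f \<omega> * g \<omega>)"
    if "integrable M g" "f \<in> borel_measurable M" "AE \<omega> in M. \<bar>f \<omega>\<bar> \<le> B" for f g :: "'a \<Rightarrow> real" and B
    using integrable_inner_bounded[of f M B g] that by simp
  \<comment> \<open>The affine bound is \<open>G exp (l (v - s\<^sup>2)) (1 + l (s\<^sup>2 - Y)) = H + s\<^sup>2 K - Y K\<close>.\<close>
  define H where "H = (\<lambda>\<omega>. exp (l \<omega> * (v - (s \<omega>)\<^sup>2)) * G \<omega>)"
  define K where "K = (\<lambda>\<omega>. l \<omega> * H \<omega>)"
  have HF: "H \<in> borel_measurable F" unfolding H_def using l s G by measurable
  have KF: "K \<in> borel_measurable F" unfolding K_def using l HF by measurable
  have H: "integrable M H" unfolding H_def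
  proof (rule mult_int[OF G(1)])
    show "AE \<omega> in M. \<bar>exp (l \<omega> * (v - (s \<omega>)\<^sup>2))\<bar> \<le> exp v"
      using ranges
    proof eventually_elim
      case (elim \<omega>)
      have "l \<omega> * (v - (s \<omega>)\<^sup>2) \<le> l \<omega> * v" using elim by (intro mult_left_mono) auto
      also have "\<dots> \<le> v" using elim v by (intro mult_left_le_one_le) auto
      finally show ?case by simp
    qed
  qed measurable
  have K: "integrable M K" unfolding K_def
  proof (rule mult_int[OF H])
    show "AE \<omega> in M. \<bar>l \<omega>\<bar> \<le> 1" using ranges by eventually_elim simp
  qed measurable
  have Ks: "integrable M (\<lambda>\<omega>. (s \<omega>)\<^sup>2 * K \<omega>)"
  proof (rule mult_int[OF K])
    show "AE \<omega> in M. \<bar>(s \<omega>)\<^sup>2\<bar> \<le> 1" using ranges by eventually_elim simp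
  qed measurable
  have KY: "integrable M (\<lambda>\<omega>. Y \<omega> * K \<omega>)"
  proof (rule mult_int[OF K])
    show "AE \<omega> in M. \<bar>Y \<omega>\<bar> \<le> 1" using ranges by eventually_elim simp
  qed measurable
  have Kpos: "AE \<omega> in M. 0 \<le> K \<omega>"
    using ranges by eventually_elim (simp add: K_def H_def G(3))
  have moment: "v * expectation K \<le> expectation (\<lambda>\<omega>. Y \<omega> * K \<omega>)"
    using variance_le_conditional_second_moment[OF X ce var m K KF Kpos]
    by (simp add: Y_def mult.commute)
  have Q_Y: "Q \<omega> = G \<omega> * hs_factor v (l \<omega>) (s \<omega>) (Y \<omega>)" for \<omega>
    by (simp add: Q_def Y_def)
  have Q: "Q \<in> borel_measurable M" unfolding Q_def by measurable
  have dom: "AE \<omega> in M. 0 \<le> Q \<omega> \<and> Q \<omega> \<le> H \<omega> + (s \<omega>)\<^sup>2 * K \<omega> - Y \<omega> * K \<omega>"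
    using ranges
  proof eventually_elim
    case (elim \<omega>)
    have "Q \<omega> \<le> G \<omega> * (exp (l \<omega> * (v - (s \<omega>)\<^sup>2)) * (1 + l \<omega> * ((s \<omega>)\<^sup>2 - Y \<omega>)))"
      unfolding Q_Y using elim by (intro mult_left_mono hs_factor_le G(3)) auto
    moreover have "0 \<le> Q \<omega>" using G(3) by (simp add: Q_def hs_factor_def)
    ultimately show ?case by (simp add: H_def K_def algebra_simps)
  qed
  have idom: "integrable M (\<lambda>\<omega>. H \<omega> + (s \<omega>)\<^sup>2 * K \<omega> - Y \<omega> * K \<omega>)"
    using H Ks KY by auto
  show iQ: "integrable M Q"
    by (rule Bochner_Integration.integrable_bound[OF idom Q]) (use dom in \<open>eventually_elim, simp\<close>)
  have "expectation Q \<le> (\<integral>\<omega>. H \<omega> + (s \<omega>)\<^sup>2 * K \<omega> - Y \<omega> * K \<omega> \<partial>M)"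
    by (rule integral_mono_AE[OF iQ idom]) (use dom in \<open>eventually_elim, simp\<close>)
  also have "\<dots> \<le> expectation H + (\<integral>\<omega>. (s \<omega>)\<^sup>2 * K \<omega> \<partial>M) - v * expectation K"
    using H Ks KY moment by simp
  also have "\<dots> = (\<integral>\<omega>. H \<omega> + (s \<omega>)\<^sup>2 * K \<omega> - v * K \<omega> \<partial>M)"
    using H K Ks by simp
  also have "\<dots> \<le> expectation G"
  proof (rule integral_mono)
    fix \<omega>
    let ?x = "l \<omega> * (v - (s \<omega>)\<^sup>2)"
    have "H \<omega> + (s \<omega>)\<^sup>2 * K \<omega> - v * K \<omega> = G \<omega> * (exp ?x * (1 + - ?x))"
      by (simp add: H_def K_def algebra_simps)
    also have "\<dots> \<le> G \<omega> * (exp ?x * exp (- ?x))"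
      by (intro mult_left_mono exp_ge_add_one_self G(3)) auto
    finally show "H \<omega> + (s \<omega>)\<^sup>2 * K \<omega> - v * K \<omega> \<le> G \<omega>"
      by (simp add: exp_minus)
  qed (use H K Ks G in auto)
  finally show "expectation Q \<le> expectation G" .
qed

section \<open>The confidence sequence\<close>

lemma measurable_canonical_filtration:
  assumes "\<And>i. 1 \<le> i \<Longrightarrow> X i \<in> borel_measurable M" "1 \<le> i" "i \<le> t"
  shows "X i \<in> borel_measurable (canonical_filtration M X t)"
proof (rule measurableI)
  fix A :: "'b set" assume A: "A \<in> sets borel"
  have "X i -` A \<inter> space M \<in> (\<Union>i\<in>{1..t}. {X i -` A \<inter> space M | A. A \<in> sets borel})"
    using A assms(2,3) by (intro UN_I[of i]) auto
  then show "X i -` A \<inter> space (canonical_filtration M X t) \<in> sets (canonical_filtration M X t)"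
    unfolding space_canonical_filtration unfolding canonical_filtration_def
    by (subst sets_measure_of) auto
qed simp

lemma canonical_filtration_mono:
  assumes "s \<le> t"
  shows "sets (canonical_filtration M X s) \<subseteq> sets (canonical_filtration M X t)"
proof -
  let ?G = "\<lambda>t. \<Union>i\<in>{1..t}. {X i -` A \<inter> space M | A. A \<in> sets borel}"
  have "?G s \<subseteq> ?G t" using assms by (intro UN_mono) auto
  moreover have "?G u \<subseteq> Pow (space M)" for u by auto
  ultimately show ?thesis
    unfolding canonical_filtration_def by (simp add: sigma_sets_mono')
qed

lemma less_U_HS_iff:
  assumes "\<And>i. i \<in> {1..t} \<Longrightarrow> 0 \<le> lam i \<omega>" and "0 < \<alpha>"
    and "(\<Sum>i=1..t. lam i \<omega>) \<noteq> 0"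
  shows "ereal v < U_HS X \<mu>h \<sigma>h lam \<alpha> t \<omega> \<longleftrightarrow>
    (\<Prod>i=1..t. hs_factor v (lam i \<omega>) (\<sigma>h i \<omega>) ((norm (X i \<omega> - \<mu>h i \<omega>))\<^sup>2)) < 1 / \<alpha>"
proof -
  let ?Y = "\<lambda>i. (norm (X i \<omega> - \<mu>h i \<omega>))\<^sup>2"
  let ?L = "\<Sum>i=1..t. lam i \<omega>"
  let ?P = "\<Sum>i=1..t. psi_E (lam i \<omega>) * (?Y i - (\<sigma>h i \<omega>)\<^sup>2)\<^sup>2"
  have L: "0 < ?L" using assms sum_nonneg[of "{1..t}" "\<lambda>i. lam i \<omega>"] by fastforce
  have "ereal v < U_HS X \<mu>h \<sigma>h lam \<alpha> t \<omega> \<longleftrightarrow>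
      v < ((\<Sum>i=1..t. lam i \<omega> * ?Y i) + (ln (1 / \<alpha>) + ?P)) / ?L"
    using assms(3) by (simp add: U_HS_def D_HS_def R_HS_def add_divide_distrib)
  also have "\<dots> \<longleftrightarrow> v * ?L - (\<Sum>i=1..t. lam i \<omega> * ?Y i) - ?P < ln (1 / \<alpha>)"
    using L by (simp add: pos_less_divide_eq) linarith
  also have "v * ?L - (\<Sum>i=1..t. lam i \<omega> * ?Y i) - ?P
      = (\<Sum>i=1..t. lam i \<omega> * (v - ?Y i) - psi_E (lam i \<omega>) * (?Y i - (\<sigma>h i \<omega>)\<^sup>2)\<^sup>2)"
    by (simp add: sum_distrib_left sum_subtractf right_diff_distrib mult.commute)
  also have "\<dots> < ln (1 / \<alpha>) \<longleftrightarrow> exp \<dots> < 1 / \<alpha>"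
    using assms(2) by (subst exp_less_cancel_iff[symmetric]) simp
  finally show ?thesis unfolding hs_factor_def by (simp only: exp_sum finite_atLeastAtMost)
qed

theorem corollaryA5:
  fixes M :: "'w measure"
    and X \<mu>h :: "nat \<Rightarrow> 'w \<Rightarrow> 'h::{real_inner, banach, second_countable_topology}"
    and \<sigma>h lam :: "nat \<Rightarrow> 'w \<Rightarrow> real"
    and \<mu> :: 'h and \<sigma> \<alpha> :: real
  defines "F \<equiv> canonical_filtration M X"
  assumes "prob_space M"
    and "\<And>t. t \<ge> 1 \<Longrightarrow> X t \<in> borel_measurable M"
    and "\<And>t. t \<ge> 1 \<Longrightarrow> AE \<omega> in M. norm (X t \<omega>) \<in> {0..1/2}"
    and "\<And>t. t \<ge> 1 \<Longrightarrow> is_cond_exp M (F (t - 1)) (X t) (\<lambda>_. \<mu>)"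
    and "\<And>t. t \<ge> 1 \<Longrightarrow>
           AE \<omega> in M. real_cond_exp M (F (t - 1)) (\<lambda>\<omega>. (norm (X t \<omega> - \<mu>))\<^sup>2) \<omega> = \<sigma>\<^sup>2"
    and "\<alpha> \<in> {0<..<1}"
    and "predictable F \<mu>h" and "\<And>i. i \<ge> 1 \<Longrightarrow> AE \<omega> in M. \<mu>h i \<omega> \<in> cball 0 (1/2)"
    and "predictable F \<sigma>h" and "\<And>i. i \<ge> 1 \<Longrightarrow> AE \<omega> in M. \<sigma>h i \<omega> \<in> {0..1}"
    and "predictable F lam" and "\<And>i. i \<ge> 1 \<Longrightarrow> AE \<omega> in M. lam i \<omega> \<in> {0..<1}"
  shows "confidence_sequence M \<alpha> (\<sigma>\<^sup>2) (\<lambda>t \<omega>. {x. ereal x < U_HS X \<mu>h \<sigma>h lam \<alpha> t \<omega>})"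
proof -
  interpret prob_space M by fact
  note X = assms(3)
  have sub: "subalgebra M (F t)" for t
    unfolding F_def using X by (rule subalgebra_canonical_filtration)
  have mono: "sets (F s) \<subseteq> sets (F t)" if "s \<le> t" for s t
    unfolding F_def using that by (rule canonical_filtration_mono)
  have XF: "X i \<in> borel_measurable (F t)" if "1 \<le> i" "i \<le> t" for i t
    unfolding F_def by (rule measurable_canonical_filtration[OF X that])
  have subF: "subalgebra (F t) (F s)" if "s \<le> t" for s t
    using mono[OF that] sub[of s] sub[of t] by (simp add: subalgebra_def)
  have preF: "\<mu>h i \<in> borel_measurable (F t)" "\<sigma>h i \<in> borel_measurable (F t)"
      "lam i \<in> borel_measurable (F t)" if i: "1 \<le> i" "i \<le> Suc t" for i t
  proof -
    from i have "i - 1 \<le> t" by simp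
    note lift = measurable_from_subalg[OF subF[OF this]]
    show "\<mu>h i \<in> borel_measurable (F t)" "\<sigma>h i \<in> borel_measurable (F t)"
        "lam i \<in> borel_measurable (F t)"
      using i(1) assms(8,10,12) by (auto simp: predictable_def intro!: lift)
  qed
  have preM: "\<mu>h i \<in> borel_measurable M" "\<sigma>h i \<in> borel_measurable M"
      "lam i \<in> borel_measurable M" if "1 \<le> i" for i
    using preF[OF that, of i] measurable_from_subalg[OF sub] by auto
  define S where "S t \<omega> =
    (\<Prod>i=1..t. hs_factor (\<sigma>\<^sup>2) (lam i \<omega>) (\<sigma>h i \<omega>) ((norm (X i \<omega> - \<mu>h i \<omega>))\<^sup>2))" for t \<omega>
  have S_Suc: "S (Suc t) \<omega> = S t \<omega> * hs_factor (\<sigma>\<^sup>2) (lam (Suc t) \<omega>) (\<sigma>h (Suc t) \<omega>)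
      ((norm (X (Suc t) \<omega> - \<mu>h (Suc t) \<omega>))\<^sup>2)" for t \<omega>
    by (simp add: S_def)
  have S_nonneg: "0 \<le> S t \<omega>" for t \<omega>
    unfolding S_def by (intro prod_nonneg) (simp add: hs_factor_def)
  have SF: "S t \<in> borel_measurable (F t)" for t
    unfolding S_def using XF preF
    by (intro borel_measurable_prod hs_factor_measurable borel_measurable_power
        borel_measurable_norm borel_measurable_diff) auto
  have step: "integrable M (\<lambda>\<omega>. indicator B \<omega> * S (Suc t) \<omega>)"
      "(\<integral>\<omega>. indicator B \<omega> * S (Suc t) \<omega> \<partial>M) \<le> (\<integral>\<omega>. indicator B \<omega> * S t \<omega> \<partial>M)"
    if int: "integrable M (S t)" and B: "B \<in> sets (F t)" for t B
  proof -
    have BM: "B \<in> sets M" using B sub[of t] by (auto simp: subalgebra_def)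
    have ce: "is_cond_exp M (F t) (X (Suc t)) (\<lambda>_. \<mu>)" using assms(5)[of "Suc t"] by simp
    have var: "AE \<omega> in M. real_cond_exp M (F t) (\<lambda>\<omega>. (norm (X (Suc t) \<omega> - \<mu>))\<^sup>2) \<omega> = \<sigma>\<^sup>2"
      using assms(6)[of "Suc t"] by simp
    have bounds: "AE \<omega> in M. norm (X (Suc t) \<omega>) \<le> 1/2" "AE \<omega> in M. norm (\<mu>h (Suc t) \<omega>) \<le> 1/2"
        "AE \<omega> in M. \<bar>\<sigma>h (Suc t) \<omega>\<bar> \<le> 1" "AE \<omega> in M. 0 \<le> lam (Suc t) \<omega> \<and> lam (Suc t) \<omega> < 1"
      using assms(4,9,11,13)[of "Suc t"] by auto
    have GF: "(\<lambda>\<omega>. indicator B \<omega> * S t \<omega>) \<in> borel_measurable (F t)"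
      using B SF by measurable
    have G: "integrable M (\<lambda>\<omega>. indicator B \<omega> * S t \<omega>)"
      using integrable_mult_indicator[OF BM int] by simp
    have G0: "0 \<le> indicator B \<omega> * S t \<omega>" for \<omega> using S_nonneg by simp
    note main = hs_factor_step[OF X[of "Suc t"] bounds(1) ce var _ preF(1)[of "Suc t" t] bounds(2)
        preF(2)[of "Suc t" t] bounds(3) preF(3)[of "Suc t" t] bounds(4) G GF G0]
    show "integrable M (\<lambda>\<omega>. indicator B \<omega> * S (Suc t) \<omega>)"
      using main(1) by (simp add: S_Suc mult.assoc)
    show "(\<integral>\<omega>. indicator B \<omega> * S (Suc t) \<omega> \<partial>M) \<le> (\<integral>\<omega>. indicator B \<omega> * S t \<omega> \<partial>M)"
      using main(2) by (simp add: S_Suc mult.assoc)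
  qed
  have int: "integrable M (S t)" for t
  proof (induction t)
    case 0
    then show ?case by (simp add: S_def)
  next
    case (Suc t)
    have "space M \<in> sets (F t)" by (metis sets.top sub subalgebra_def)
    from step(1)[OF Suc this] show ?case
      by (subst (asm) Bochner_Integration.integrable_cong[where g = "S (Suc t)"]) auto
  qed
  have ville: "1 - 1 / (1 / \<alpha>) \<le> prob {\<omega>\<in>space M. \<forall>t. S t \<omega> < 1 / \<alpha>}"
  proof (rule ville_inequality[of F])
    have "S 0 = (\<lambda>_. 1)" by (simp add: S_def fun_eq_iff)
    then show "expectation (S 0) \<le> 1" by (simp add: prob_space)
    show "sets (F t) \<subseteq> sets (F (Suc t))" for t by (rule mono) simp
    show "0 < 1 / \<alpha>" using assms(7) by simp
  qed (fact sub SF int S_nonneg step(2)[OF int])+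
  let ?C = "{\<omega>\<in>space M. \<forall>t\<ge>1. \<sigma>\<^sup>2 \<in> {x. ereal x < U_HS X \<mu>h \<sigma>h lam \<alpha> t \<omega>}}"
  have "U_HS X \<mu>h \<sigma>h lam \<alpha> t \<in> borel_measurable M" if "1 \<le> t" for t
  proof -
    have [measurable]: "(\<lambda>\<omega>. \<Sum>i=1..t. lam i \<omega>) \<in> borel_measurable M"
        "(\<lambda>\<omega>. \<Sum>i=1..t. lam i \<omega> * (norm (X i \<omega> - \<mu>h i \<omega>))\<^sup>2) \<in> borel_measurable M"
        "(\<lambda>\<omega>. \<Sum>i=1..t. psi_E (lam i \<omega>) * ((norm (X i \<omega> - \<mu>h i \<omega>))\<^sup>2 - (\<sigma>h i \<omega>)\<^sup>2)\<^sup>2) \<in> borel_measurable M"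
      using X preM unfolding psi_E_def
      by (auto intro!: borel_measurable_sum borel_measurable_times borel_measurable_power
          borel_measurable_norm borel_measurable_diff borel_measurable_uminus borel_measurable_ln)
    show ?thesis
      unfolding U_HS_def D_HS_def R_HS_def by measurable
  qed
  then have C: "?C \<in> sets M"
    by measurable
  \<comment> \<open>When all weights so far vanish, the bound is infinite and nothing is to be shown.\<close>
  have "AE \<omega> in M. \<forall>i. 1 \<le> i \<longrightarrow> 0 \<le> lam i \<omega>"
    unfolding AE_all_countable using assms(13) by auto
  then have "AE \<omega> in M. \<omega> \<in> {\<omega>\<in>space M. \<forall>t. S t \<omega> < 1 / \<alpha>} \<longrightarrow> \<omega> \<in> ?C"
  proof eventually_elim
    case (elim \<omega>)
    have "ereal (\<sigma>\<^sup>2) < U_HS X \<mu>h \<sigma>h lam \<alpha> t \<omega>" if "S t \<omega> < 1 / \<alpha>" for t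
    proof (cases "(\<Sum>i=1..t. lam i \<omega>) = 0")
      case True
      then show ?thesis by (simp add: U_HS_def)
    next
      case False
      then show ?thesis
        using elim assms(7) that by (subst less_U_HS_iff) (auto simp: S_def)
    qed
    then show ?case by auto
  qed
  then have "prob {\<omega>\<in>space M. \<forall>t. S t \<omega> < 1 / \<alpha>} \<le> prob ?C"
    by (rule finite_measure_mono_AE[OF _ C])
  then have "1 - \<alpha> \<le> prob ?C"
    using ville by (simp only: divide_divide_eq_right mult_1 div_by_1)
  with C show ?thesis
    unfolding confidence_sequence_def by (rule conjI)
qed

end
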